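(* Let $\{X_n\}_{n\ge0}$ be an irreducible Markov chain with state space $\{1,2,3\}$, transition matrix $P=[p_{ij}]$ and stationary distribution $(\pi_1,\pi_2,\pi_3)$. The distribution $f_{1,n}=P\{T_1^{(0)}=n\mid X_0=1\}$ of the mixing time $T_1^{(0)}$ is given by $$f_{1,0}=\pi_1,\quad f_{1,1}=\pi_2p_{12}+\pi_3p_{13},\quad f_{1,2}=\pi_2(p_{11}p_{12}+p_{13}p_{32})+\pi_3(p_{11}p_{13}+p_{12}p_{23}),$$ $$f_{1,3}=\pi_2(p_{11}p_{11}p_{12}+p_{11}p_{13}p_{32}+p_{13}p_{33}p_{32}+p_{13}p_{31}p_{12})+\pi_3(p_{11}p_{11}p_{13}+p_{11}p_{12}p_{23}+p_{12}p_{22}p_{23}+p_{12}p_{21}p_{13}),$$ and, for $n\ge3$, provided $\delta_2>0$ and $\delta_3>0$, $$f_{1,n}=\pi_2\left(\frac{a(\lambda_{21})}{\lambda_{21}-\lambda_{23}}\lambda_{21}^{n-1}-\frac{a(\lambda_{23})}{\lambda_{21}-\lambda_{23}}\lambda_{23}^{n-1}\right)+\pi_3\left(\frac{b(\lambda_{31})}{\lambda_{31}-\lambda_{32}}\lambda_{31}^{n-1}-\frac{b(\lambda_{32})}{\lambda_{31}-\lambda_{32}}\lambda_{32}^{n-1}\right),$$ where $$\lambda_{21}=\frac{p_{11}+p_{33}+\delta_2}{2},\quad\lambda_{23}=\frac{p_{11}+p_{33}-\delta_2}{2},\quad\delta_2=\sqrt{(p_{11}-p_{33})^2+4p_{13}p_{31}},$$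 $$\lambda_{31}=\frac{p_{11}+p_{22}+\delta_3}{2},\quad\lambda_{32}=\frac{p_{11}+p_{22}-\delta_3}{2},\quad\delta_3=\sqrt{(p_{11}-p_{22})^2+4p_{12}p_{21}},$$ and $a(\lambda)=p_{12}\lambda+p_{13}p_{32}-p_{12}p_{33}$, $b(\lambda)=p_{13}\lambda+p_{12}p_{23}-p_{13}p_{22}$.
   Context: The mixing variable $M$ is a random variable, independent of the chain, with $P[M=j]=\pi_j$ for $j\in\{1,2,3\}$. Given $X_0=1$, $T_1^{(0)}=\min\{n\ge0:X_n=M\}$. *)

theory Defs
  imports "HOL-Probability.Probability"
begin

text \<open>The state space is the type \<open>3\<close>, whose elements are \<open>1\<close>, \<open>2\<close> and \<open>3\<close> (the numeral \<open>3\<close>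
  of this type is equal to \<open>0\<close>). The entry \<open>p_ij\<close> of a matrix is \<open>P $ i $ j\<close>.\<close>

definition stochastic_matrix :: "real ^ 's ^ 's::finite \<Rightarrow> bool" where
  "stochastic_matrix P \<longleftrightarrow> (\<forall>i j. 0 \<le> P $ i $ j) \<and> (\<forall>i. (\<Sum>j\<in>UNIV. P $ i $ j) = 1)"

text \<open>The class instance \<open>(^)\<close> is not the matrix power: multiplication on \<open>real ^ 's ^ 's\<close> is
  componentwise.\<close>

primrec matrix_pow :: "real ^ 's ^ 's::finite \<Rightarrow> nat \<Rightarrow> real ^ 's ^ 's" where
  "matrix_pow P 0 = mat 1"
| "matrix_pow P (Suc n) = matrix_pow P n ** P"

definition irreducible_matrix :: "real ^ 's ^ 's::finite \<Rightarrow> bool" where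
  "irreducible_matrix P \<longleftrightarrow> (\<forall>i j. \<exists>n. 0 < matrix_pow P n $ i $ j)"

definition stationary_distribution :: "real ^ 's ^ 's::finite \<Rightarrow> real ^ 's \<Rightarrow> bool" where
  "stationary_distribution P \<pi> \<longleftrightarrow>
     (\<forall>i. 0 \<le> \<pi> $ i) \<and> (\<Sum>i\<in>UNIV. \<pi> $ i) = 1 \<and> \<pi> v* P = \<pi>"

text \<open>Time-homogeneous Markov chain with an arbitrary initial distribution. The Markov property is
  required for histories of positive probability, where the conditional probability is meaningful.\<close>

definition markov_chain ::
    "'w measure \<Rightarrow> (nat \<Rightarrow> 'w \<Rightarrow> 's::finite) \<Rightarrow> real ^ 's ^ 's \<Rightarrow> bool" where
  "markov_chain \<Omega> X P \<longleftrightarrow>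
     prob_space \<Omega> \<and> stochastic_matrix P \<and>
     (\<forall>n. X n \<in> \<Omega> \<rightarrow>\<^sub>M count_space UNIV) \<and>
     (\<forall>n x. 0 < \<P>(\<omega> in \<Omega>. \<forall>k\<le>n. X k \<omega> = x k) \<longrightarrow>
        \<P>(\<omega> in \<Omega>. X (Suc n) \<omega> = x (Suc n) \<bar> \<forall>k\<le>n. X k \<omega> = x k) = P $ x n $ x (Suc n))"

text \<open>Independence of the whole process: the sigma-algebras generated by \<open>M\<close> and by the process, seen
  as a random element of the product space, are independent. (The library's \<open>indep_var\<close> requires both
  variables to take values in the same type.)\<close>

definition mixing_variable ::
    "'w measure \<Rightarrow> (nat \<Rightarrow> 'w \<Rightarrow> 's::finite) \<Rightarrow> real ^ 's \<Rightarrow> ('w \<Rightarrow> 's) \<Rightarrow> bool" where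
  "mixing_variable \<Omega> X \<pi> M \<longleftrightarrow>
     M \<in> \<Omega> \<rightarrow>\<^sub>M count_space UNIV \<and>
     (\<forall>j. \<P>(\<omega> in \<Omega>. M \<omega> = j) = \<pi> $ j) \<and>
     prob_space.indep_set \<Omega>
       (sets (vimage_algebra (space \<Omega>) M (count_space UNIV)))
       (sets (vimage_algebra (space \<Omega>) (\<lambda>\<omega> n. X n \<omega>) (\<Pi>\<^sub>M n\<in>UNIV. count_space UNIV)))"

text \<open>The value is \<open>\<infinity>\<close> (the infimum of the empty set) if the chain never meets \<open>M\<close>; otherwise the
  infimum is a minimum.\<close>

definition mixing_time :: "(nat \<Rightarrow> 'w \<Rightarrow> 's) \<Rightarrow> ('w \<Rightarrow> 's) \<Rightarrow> 'w \<Rightarrow> enat" where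
  "mixing_time X M \<omega> = Inf {enat n | n. X n \<omega> = M \<omega>}"

end

theory Submission imports Defs begin

text \<open>Since \<open>M\<close> is independent of the chain, \<open>f n\<close> is the \<open>\<pi>\<close>-average over the targets \<open>j\<close> of the
  first-passage probabilities from \<open>1\<close> to \<open>j\<close>. For \<open>j = 2\<close> and \<open>j = 3\<close> the chain moves, before it hits
  \<open>j\<close>, between the two remaining states, so the first-passage probabilities satisfy the linear
  recurrence given by the characteristic polynomial of the corresponding \<open>2 \<times> 2\<close> block of \<open>P\<close>; its
  roots are the \<open>\<lambda>\<close>'s.\<close>

section \<open>One-step relations for a finite chain\<close>

text \<open>\<open>markov_chain\<close> speaks only about single complete histories. There are
  finitely many histories up to time \<open>n\<close>, and on those ending in \<open>t\<close> the
  transition factor is always \<open>P $ t $ s\<close>, so it can be pulled out of the sum over all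
  histories satisfying \<open>A\<close>.\<close>

lemma markov_chain_step:
  fixes P :: "real ^ 's ^ 's::finite"
  assumes "markov_chain \<Omega> X P"
  shows "\<P>(\<omega> in \<Omega>. X (Suc n) \<omega> = s \<and> X n \<omega> = t \<and> A (\<lambda>k\<in>{..n}. X k \<omega>))
    = \<P>(\<omega> in \<Omega>. X n \<omega> = t \<and> A (\<lambda>k\<in>{..n}. X k \<omega>)) * P $ t $ s"
proof -
  interpret prob_space \<Omega> using assms by (simp add: markov_chain_def)
  have [measurable]: "X k \<in> \<Omega> \<rightarrow>\<^sub>M count_space UNIV" for k
    using assms by (simp add: markov_chain_def)
  \<comment> \<open>Extensional functions represent each history up to time \<open>n\<close> exactly
    once. This makes \<open>H\<close> finite and the cylinders \<open>E x\<close> disjoint.\<close>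
  define H where "H = {x \<in> {..n} \<rightarrow>\<^sub>E (UNIV :: 's set). x n = t \<and> A x}"
  define E where "E x = {\<omega> \<in> space \<Omega>. \<forall>k\<le>n. X k \<omega> = x k}" for x
  define F where "F x = {\<omega> \<in> space \<Omega>. X (Suc n) \<omega> = s \<and> (\<forall>k\<le>n. X k \<omega> = x k)}" for x
  have fin: "finite H" unfolding H_def
    by (rule finite_subset[of _ "{..n} \<rightarrow>\<^sub>E UNIV"]) (auto intro: finite_PiE)
  have meas [measurable]: "E x \<in> sets \<Omega>" "F x \<in> sets \<Omega>" for x
    unfolding E_def F_def by measurable
  have history: "x = (\<lambda>k\<in>{..n}. X k \<omega>)" if "\<forall>k\<le>n. X k \<omega> = x k" "x \<in> H" for x \<omega>
    by (rule PiE_ext[of _ "{..n}" "\<lambda>_. UNIV"]) (use that in \<open>auto simp: H_def\<close>)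
  have same_history: "x = y" if "x \<in> H" "y \<in> H" "\<omega> \<in> E x" "\<omega> \<in> E y" for x y \<omega>
    using history[of \<omega> x] history[of \<omega> y] that by (simp add: E_def)
  have "F x \<subseteq> E x" for x by (auto simp: E_def F_def)
  then have disj: "disjoint_family_on E H" "disjoint_family_on F H"
    unfolding disjoint_family_on_def using same_history by blast+
  have in_H: "(\<lambda>k\<in>{..n}. X k \<omega>) \<in> H" if "X n \<omega> = t" "A (\<lambda>k\<in>{..n}. X k \<omega>)" for \<omega>
    using that by (auto simp: H_def)
  have E_eq: "{\<omega> \<in> space \<Omega>. X n \<omega> = t \<and> A (\<lambda>k\<in>{..n}. X k \<omega>)} = (\<Union>x\<in>H. E x)"
  proof (intro subset_antisym subsetI)
    fix \<omega> assume "\<omega> \<in> {\<omega> \<in> space \<Omega>. X n \<omega> = t \<and> A (\<lambda>k\<in>{..n}. X k \<omega>)}"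
    then show "\<omega> \<in> (\<Union>x\<in>H. E x)"
      using in_H[of \<omega>] by (intro UN_I[of "\<lambda>k\<in>{..n}. X k \<omega>"]) (auto simp: E_def)
  next
    fix \<omega> assume "\<omega> \<in> (\<Union>x\<in>H. E x)"
    then obtain x where x: "x \<in> H" "\<omega> \<in> E x" by blast
    then have "x = (\<lambda>k\<in>{..n}. X k \<omega>)" using history by (simp add: E_def)
    then show "\<omega> \<in> {\<omega> \<in> space \<Omega>. X n \<omega> = t \<and> A (\<lambda>k\<in>{..n}. X k \<omega>)}"
      using x by (auto simp: H_def E_def)
  qed
  have "{\<omega> \<in> space \<Omega>. X (Suc n) \<omega> = s \<and> X n \<omega> = t \<and> A (\<lambda>k\<in>{..n}. X k \<omega>)}
      = {\<omega> \<in> space \<Omega>. X n \<omega> = t \<and> A (\<lambda>k\<in>{..n}. X k \<omega>)} \<inter> {\<omega>. X (Suc n) \<omega> = s}"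
    by auto
  also have "\<dots> = (\<Union>x\<in>H. F x)"
    unfolding E_eq by (auto simp: E_def F_def)
  finally have F_eq: "{\<omega> \<in> space \<Omega>. X (Suc n) \<omega> = s \<and> X n \<omega> = t \<and> A (\<lambda>k\<in>{..n}. X k \<omega>)}
      = (\<Union>x\<in>H. F x)" .
  have step: "prob (F x) = prob (E x) * P $ t $ s" if "x \<in> H" for x
  proof (cases "prob (E x) = 0")
    \<comment> \<open>The Markov property is silent about null histories, but \<open>F x\<close>
      lies inside \<open>E x\<close>, so both sides vanish.\<close>
    case True
    have "prob (F x) \<le> prob (E x)"
      by (intro finite_measure_mono meas) (auto simp: E_def F_def)
    then show ?thesis using True measure_nonneg[of \<Omega> "F x"] by simp
  next
    case False
    \<comment> \<open>In \<open>markov_chain\<close> one sequence supplies both the history and the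
      next state. Overwriting the entry at \<open>Suc n\<close> selects the target \<open>s\<close>
      and keeps the history.\<close>
    define y where "y = x(Suc n := s)"
    have y: "(\<forall>k\<le>n. X k \<omega> = y k) = (\<forall>k\<le>n. X k \<omega> = x k)" for \<omega>
      by (auto simp: y_def)
    have "0 < \<P>(\<omega> in \<Omega>. \<forall>k\<le>n. X k \<omega> = y k) \<longrightarrow>
        \<P>(\<omega> in \<Omega>. X (Suc n) \<omega> = y (Suc n) \<bar> \<forall>k\<le>n. X k \<omega> = y k) = P $ y n $ y (Suc n)"
      using assms unfolding markov_chain_def by blast
    moreover have "0 < prob (E x)" using False by (simp add: zero_less_measure_iff)
    ultimately have "\<P>(\<omega> in \<Omega>. X (Suc n) \<omega> = s \<bar> \<forall>k\<le>n. X k \<omega> = x k) = P $ t $ s"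
      unfolding y using that by (simp add: y_def H_def E_def)
    then show ?thesis
      using False by (simp add: cond_prob_def E_def F_def field_simps)
  qed
  have "prob (\<Union>x\<in>H. F x) = (\<Sum>x\<in>H. prob (F x))"
    by (rule finite_measure_finite_Union) (use fin disj in auto)
  also have "\<dots> = (\<Sum>x\<in>H. prob (E x)) * P $ t $ s"
    by (simp add: step sum_distrib_right)
  also have "(\<Sum>x\<in>H. prob (E x)) = prob (\<Union>x\<in>H. E x)"
    by (rule finite_measure_finite_Union[symmetric]) (use fin disj in auto)
  finally show ?thesis
    unfolding E_eq F_eq .
qed

text \<open>The event is split by the state at time \<open>n\<close>, which the taboo keeps away
  from \<open>j\<close>. Since \<open>s\<close> itself may be \<open>j\<close>, the same relation
  also produces first-passage probabilities.\<close>

lemma markov_chain_taboo_step: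
  fixes P :: "real ^ 's ^ 's::finite"
  assumes "markov_chain \<Omega> X P"
  shows "\<P>(\<omega> in \<Omega>. X (Suc n) \<omega> = s \<and> (\<forall>k<Suc n. X k \<omega> \<noteq> j) \<and> X 0 \<omega> = i)
    = (\<Sum>t\<in>UNIV - {j}. \<P>(\<omega> in \<Omega>. X n \<omega> = t \<and> (\<forall>k<n. X k \<omega> \<noteq> j) \<and> X 0 \<omega> = i) * P $ t $ s)"
proof -
  interpret prob_space \<Omega> using assms by (simp add: markov_chain_def)
  have [measurable]: "X k \<in> \<Omega> \<rightarrow>\<^sub>M count_space UNIV" for k
    using assms by (simp add: markov_chain_def)
  define B where "B t = {\<omega> \<in> space \<Omega>. X (Suc n) \<omega> = s \<and> X n \<omega> = t \<and> (\<forall>k<n. X k \<omega> \<noteq> j) \<and> X 0 \<omega> = i}" for t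
  have [measurable]: "B t \<in> sets \<Omega>" for t
    unfolding B_def by measurable
  have "{\<omega> \<in> space \<Omega>. X (Suc n) \<omega> = s \<and> (\<forall>k<Suc n. X k \<omega> \<noteq> j) \<and> X 0 \<omega> = i} = (\<Union>t\<in>UNIV - {j}. B t)"
    by (auto simp: B_def less_Suc_eq)
  also have "prob \<dots> = (\<Sum>t\<in>UNIV - {j}. prob (B t))"
    by (rule finite_measure_finite_Union) (auto simp: disjoint_family_on_def B_def)
  moreover have "prob (B t) = \<P>(\<omega> in \<Omega>. X n \<omega> = t \<and> (\<forall>k<n. X k \<omega> \<noteq> j) \<and> X 0 \<omega> = i) * P $ t $ s" for t
    unfolding B_def
    using markov_chain_step[OF assms, of n s t "\<lambda>x. (\<forall>k<n. x k \<noteq> j) \<and> x 0 = i"] by simp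
  ultimately show ?thesis by simp
qed

section \<open>First passage with three states\<close>

text \<open>The row vector \<open>(u n i, u n l)\<close> is multiplied at each step by the 2 x 2
  block of \<open>P\<close> on the states \<open>i\<close> and \<open>l\<close>. By Cayley-Hamilton
  it satisfies the recurrence with the trace and determinant of that block. For positive times
  \<open>g\<close> is a fixed linear functional of the preceding vector and inherits the recurrence,
  which is why it starts at index 1 and not at 0.\<close>

lemma first_passage_three_states:
  fixes P :: "real ^ 's ^ 's::finite" and g :: "nat \<Rightarrow> real"
  assumes "markov_chain \<Omega> X P"
    and UNIV: "(UNIV :: 's set) = {i, j, l}" and distinct: "i \<noteq> j" "i \<noteq> l" "j \<noteq> l"
    and g: "\<And>n. g n = \<P>(\<omega> in \<Omega>. X n \<omega> = j \<and> (\<forall>k<n. X k \<omega> \<noteq> j) \<and> X 0 \<omega> = i)"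
  shows "g 1 = \<P>(\<omega> in \<Omega>. X 0 \<omega> = i) * P $ i $ j"
    and "g 2 = \<P>(\<omega> in \<Omega>. X 0 \<omega> = i) * (P $ i $ i * P $ i $ j + P $ i $ l * P $ l $ j)"
    and "g (n + 3) = (P $ i $ i + P $ l $ l) * g (n + 2)
      - (P $ i $ i * P $ l $ l - P $ i $ l * P $ l $ i) * g (n + 1)"
proof -
  define u where "u n s = \<P>(\<omega> in \<Omega>. X n \<omega> = s \<and> (\<forall>k<n. X k \<omega> \<noteq> j) \<and> X 0 \<omega> = i)" for n s
  have "UNIV - {j} = {i, l}" using UNIV distinct by auto
  then have u_Suc: "u (Suc n) s = u n i * P $ i $ s + u n l * P $ l $ s" for n s
    unfolding u_def markov_chain_taboo_step[OF assms(1)] using distinct by simp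
  have empty: "{\<omega> \<in> space \<Omega>. X 0 \<omega> = l \<and> X 0 \<omega> = i} = {}" using distinct by auto
  have u_0: "u 0 i = \<P>(\<omega> in \<Omega>. X 0 \<omega> = i)" "u 0 l = 0"
    unfolding u_def using distinct by (auto intro!: arg_cong[of _ _ "measure \<Omega>"] simp: empty)
  have g_u: "g = (\<lambda>n. u n j)" by (simp add: g u_def fun_eq_iff)
  show "g 1 = \<P>(\<omega> in \<Omega>. X 0 \<omega> = i) * P $ i $ j"
    "g 2 = \<P>(\<omega> in \<Omega>. X 0 \<omega> = i) * (P $ i $ i * P $ i $ j + P $ i $ l * P $ l $ j)"
    "g (n + 3) = (P $ i $ i + P $ l $ l) * g (n + 2)
      - (P $ i $ i * P $ l $ l - P $ i $ l * P $ l $ i) * g (n + 1)"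
    by (simp_all add: g_u u_0 u_Suc numeral_eq_Suc algebra_simps)
qed

text \<open>Both geometric sequences solve the recurrence. The coefficients are those that match
  \<open>g 0\<close> and \<open>g 1\<close>, hence an induction with two base cases.\<close>

lemma linear_recurrence_closed_form:
  fixes g :: "nat \<Rightarrow> 'a::field"
  assumes "\<And>n. g (n + 2) = (x + y) * g (n + 1) - x * y * g n" and "x \<noteq> y"
  shows "g n = (g 1 - y * g 0) / (x - y) * x ^ n - (g 1 - x * g 0) / (x - y) * y ^ n"
proof (induction n rule: induct_nat_012)
  case 0
  show ?case using assms(2) by (simp add: divide_simps) (simp add: algebra_simps)
next
  case 1
  show ?case using assms(2) by (simp add: divide_simps) (simp add: algebra_simps)
next
  case (ge2 n)
  define c d where "c = (g 1 - y * g 0) / (x - y)" and "d = (g 1 - x * g 0) / (x - y)"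
  have "g (Suc (Suc n)) = (x + y) * g (Suc n) - x * y * g n"
    using assms(1)[of n] by simp
  also have "\<dots> = (x + y) * (c * x ^ Suc n - d * y ^ Suc n) - x * y * (c * x ^ n - d * y ^ n)"
    using ge2 by (simp add: c_def d_def)
  also have "\<dots> = c * x ^ Suc (Suc n) - d * y ^ Suc (Suc n)"
    by (simp add: algebra_simps)
  finally show ?case unfolding c_def d_def .
qed

lemma first_passage_closed_form:
  fixes P :: "real ^ 's ^ 's::finite" and g :: "nat \<Rightarrow> real"
  assumes chain: "markov_chain \<Omega> X P"
    and states: "(UNIV :: 's set) = {i, j, l}" "i \<noteq> j" "i \<noteq> l" "j \<noteq> l"
    and g: "\<And>n. g n = \<P>(\<omega> in \<Omega>. X n \<omega> = j \<and> (\<forall>k<n. X k \<omega> \<noteq> j) \<and> X 0 \<omega> = i)"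
    and d: "d = sqrt ((P $ i $ i - P $ l $ l)\<^sup>2 + 4 * P $ i $ l * P $ l $ i)" "0 < d"
    and x: "x = (P $ i $ i + P $ l $ l + d) / 2" and y: "y = (P $ i $ i + P $ l $ l - d) / 2"
    and c: "\<And>z. c z = P $ i $ j * z + P $ i $ l * P $ l $ j - P $ i $ j * P $ l $ l"
    and n: "n \<ge> 1"
  shows "g n = \<P>(\<omega> in \<Omega>. X 0 \<omega> = i) * (c x / (x - y) * x ^ (n - 1) - c y / (x - y) * y ^ (n - 1))"
proof -
  note passage = first_passage_three_states[OF chain states g]
  define q where "q = \<P>(\<omega> in \<Omega>. X 0 \<omega> = i)"
  \<comment> \<open>Positivity of \<open>d\<close> makes the radicand positive, so squaring undoes
    the root. Then \<open>x\<close> and \<open>y\<close> have the trace and the determinant of the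
    block as sum and product.\<close>
  have "d\<^sup>2 = (P $ i $ i - P $ l $ l)\<^sup>2 + 4 * P $ i $ l * P $ l $ i"
    using d by simp
  moreover have "4 * (x * y) = (P $ i $ i + P $ l $ l)\<^sup>2 - d\<^sup>2"
    unfolding x y by (simp add: field_simps power2_eq_square)
  ultimately have prod: "x * y = P $ i $ i * P $ l $ l - P $ i $ l * P $ l $ i"
    by (simp add: power2_eq_square algebra_simps)
  have sum: "x + y = P $ i $ i + P $ l $ l" unfolding x y by (simp add: field_simps)
  have "x \<noteq> y" using d(2) x y by simp
  have c_x: "g 2 - y * g 1 = q * c x"
  proof -
    have "g 2 - y * g 1 = q * (P $ i $ j * (P $ i $ i - y) + P $ i $ l * P $ l $ j)"
      unfolding passage(1,2) q_def by (simp add: algebra_simps)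
    also have "P $ i $ i - y = x - P $ l $ l" using sum by simp
    finally show ?thesis unfolding c by (simp add: algebra_simps)
  qed
  have c_y: "g 2 - x * g 1 = q * c y"
  proof -
    have "g 2 - x * g 1 = q * (P $ i $ j * (P $ i $ i - x) + P $ i $ l * P $ l $ j)"
      unfolding passage(1,2) q_def by (simp add: algebra_simps)
    also have "P $ i $ i - x = y - P $ l $ l" using sum by simp
    finally show ?thesis unfolding c by (simp add: algebra_simps)
  qed
  obtain m where m: "n = Suc m" using n by (cases n) auto
  \<comment> \<open>The closed form is applied to the sequence shifted by one, with initial values
    \<open>g 1\<close> and \<open>g 2\<close>; hence the exponent \<open>n - 1\<close>.\<close>
  have "g (Suc m) = (g 2 - y * g 1) / (x - y) * x ^ m - (g 2 - x * g 1) / (x - y) * y ^ m"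
    using linear_recurrence_closed_form[of "\<lambda>n. g (Suc n)" x y m, OF _ \<open>x \<noteq> y\<close>] passage(3)
    by (simp add: sum prod numeral_eq_Suc)
  also have "\<dots> = q * (c x / (x - y) * x ^ m - c y / (x - y) * y ^ m)"
    unfolding c_x c_y by (simp add: right_diff_distrib)
  finally show ?thesis by (simp add: m q_def)
qed

section \<open>From the mixing time to first passages\<close>

lemma mixing_time_eq_enat_iff:
  "mixing_time X M \<omega> = enat n \<longleftrightarrow> X n \<omega> = M \<omega> \<and> (\<forall>k<n. X k \<omega> \<noteq> M \<omega>)"
proof
  assume T: "mixing_time X M \<omega> = enat n"
  \<comment> \<open>The infimum of the empty set is infinite, so a finite value forces the set to be
    nonempty; by well-ordering the infimum is then attained.\<close>
  then have "{enat n |n. X n \<omega> = M \<omega>} \<noteq> {}"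
    unfolding mixing_time_def by (metis Inf_empty enat.distinct(1) top_enat_def)
  then have "mixing_time X M \<omega> \<in> {enat n |n. X n \<omega> = M \<omega>}"
    unfolding mixing_time_def by (metis (no_types, lifting) all_not_in_conv wellorder_InfI)
  moreover have "\<not> k < n" if "X k \<omega> = M \<omega>" for k
  proof -
    have "mixing_time X M \<omega> \<le> enat k"
      unfolding mixing_time_def using that by (intro Inf_lower) auto
    then show ?thesis by (simp add: T)
  qed
  ultimately show "X n \<omega> = M \<omega> \<and> (\<forall>k<n. X k \<omega> \<noteq> M \<omega>)" by (auto simp: T)
next
  assume "X n \<omega> = M \<omega> \<and> (\<forall>k<n. X k \<omega> \<noteq> M \<omega>)"
  then show "mixing_time X M \<omega> = enat n"
    unfolding mixing_time_def by (intro Inf_eqI) (auto simp: not_less[symmetric])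
qed

text \<open>On \<open>M \<omega> = j\<close> the random target is the constant \<open>j\<close>, and
  what remains is an event of the process alone. Independence then factors out
  \<open>\<pi> $ j\<close>.\<close>

lemma prob_mixing_time:
  fixes P :: "real ^ 's ^ 's::finite"
  assumes chain: "markov_chain \<Omega> X P" and mixing: "mixing_variable \<Omega> X \<pi> M"
  shows "\<P>(\<omega> in \<Omega>. mixing_time X M \<omega> = enat n \<and> X 0 \<omega> = i)
    = (\<Sum>j\<in>UNIV. \<pi> $ j * \<P>(\<omega> in \<Omega>. X n \<omega> = j \<and> (\<forall>k<n. X k \<omega> \<noteq> j) \<and> X 0 \<omega> = i))"
proof -
  interpret prob_space \<Omega> using chain by (simp add: markov_chain_def)
  have [measurable]: "X k \<in> \<Omega> \<rightarrow>\<^sub>M count_space UNIV" for k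
    using chain by (simp add: markov_chain_def)
  have [measurable]: "M \<in> \<Omega> \<rightarrow>\<^sub>M count_space UNIV"
    using mixing by (simp add: mixing_variable_def)
  define A where "A j = {\<omega> \<in> space \<Omega>. M \<omega> = j}" for j
  define B where "B j = {\<omega> \<in> space \<Omega>. X n \<omega> = j \<and> (\<forall>k<n. X k \<omega> \<noteq> j) \<and> X 0 \<omega> = i}" for j
  have [measurable]: "A j \<in> sets \<Omega>" "B j \<in> sets \<Omega>" for j
    unfolding A_def B_def by measurable
  have indep: "prob (A j \<inter> B j) = prob (A j) * prob (B j)" for j
  proof (rule indep_setD)
    show "indep_set (sets (vimage_algebra (space \<Omega>) M (count_space UNIV)))
        (sets (vimage_algebra (space \<Omega>) (\<lambda>\<omega> n. X n \<omega>) (\<Pi>\<^sub>M n\<in>UNIV. count_space UNIV)))"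
      using mixing by (simp add: mixing_variable_def)
    have "A j = M -` {j} \<inter> space \<Omega>" by (auto simp: A_def)
    also have "\<dots> \<in> sets (vimage_algebra (space \<Omega>) M (count_space UNIV))"
      by (rule in_vimage_algebra) simp
    finally show "A j \<in> sets (vimage_algebra (space \<Omega>) M (count_space UNIV))" .
    \<comment> \<open>Independence is stated for the sigma-algebra of the whole path, so
      \<open>B j\<close> is exhibited as the preimage of a measurable set of paths.\<close>
    let ?C = "{x \<in> space (\<Pi>\<^sub>M n\<in>UNIV. count_space UNIV). x n = j \<and> (\<forall>k<n. x k \<noteq> j) \<and> x 0 = i}"
    have "B j = (\<lambda>\<omega> n. X n \<omega>) -` ?C \<inter> space \<Omega>"
      by (auto simp: B_def space_PiM)
    also have "\<dots> \<in> sets (vimage_algebra (space \<Omega>) (\<lambda>\<omega> n. X n \<omega>) (\<Pi>\<^sub>M n\<in>UNIV. count_space UNIV))"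
      by (rule in_vimage_algebra) measurable
    finally show "B j \<in> sets (vimage_algebra (space \<Omega>) (\<lambda>\<omega> n. X n \<omega>) (\<Pi>\<^sub>M n\<in>UNIV. count_space UNIV))" .
  qed
  have "{\<omega> \<in> space \<Omega>. mixing_time X M \<omega> = enat n \<and> X 0 \<omega> = i} = (\<Union>j. A j \<inter> B j)"
    by (auto simp: mixing_time_eq_enat_iff A_def B_def)
  also have "prob \<dots> = (\<Sum>j\<in>UNIV. prob (A j \<inter> B j))"
    by (rule finite_measure_finite_Union) (auto simp: disjoint_family_on_def A_def)
  also have "\<dots> = (\<Sum>j\<in>UNIV. \<pi> $ j * prob (B j))"
    unfolding indep using mixing by (simp add: mixing_variable_def A_def)
  finally show ?thesis unfolding B_def .
qed

section \<open>Assembling the distribution\<close>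

theorem theorem4p6:
  fixes \<Omega> :: "'w measure" and X :: "nat \<Rightarrow> 'w \<Rightarrow> 3" and M :: "'w \<Rightarrow> 3"
    and P :: "real ^ 3 ^ 3" and \<pi> :: "real ^ 3"
    and p :: "3 \<Rightarrow> 3 \<Rightarrow> real" and f :: "nat \<Rightarrow> real"
    and \<delta>2 \<delta>3 lam21 lam23 lam31 lam32 :: real and a b :: "real \<Rightarrow> real"
  assumes chain: "markov_chain \<Omega> X P"
    and irreducible: "irreducible_matrix P"
    and stationary: "stationary_distribution P \<pi>"
    and mixing: "mixing_variable \<Omega> X \<pi> M"
    and start: "0 < \<P>(\<omega> in \<Omega>. X 0 \<omega> = 1)"
    and p: "\<And>i j. p i j = P $ i $ j"
    and f: "\<And>n. f n = \<P>(\<omega> in \<Omega>. mixing_time X M \<omega> = enat n \<bar> X 0 \<omega> = 1)"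
    and \<delta>2: "\<delta>2 = sqrt ((p 1 1 - p 3 3)^2 + 4 * p 1 3 * p 3 1)"
    and \<delta>3: "\<delta>3 = sqrt ((p 1 1 - p 2 2)^2 + 4 * p 1 2 * p 2 1)"
    and lam21: "lam21 = (p 1 1 + p 3 3 + \<delta>2) / 2"
    and lam23: "lam23 = (p 1 1 + p 3 3 - \<delta>2) / 2"
    and lam31: "lam31 = (p 1 1 + p 2 2 + \<delta>3) / 2"
    and lam32: "lam32 = (p 1 1 + p 2 2 - \<delta>3) / 2"
    and a: "\<And>x. a x = p 1 2 * x + p 1 3 * p 3 2 - p 1 2 * p 3 3"
    and b: "\<And>x. b x = p 1 3 * x + p 1 2 * p 2 3 - p 1 3 * p 2 2"
  shows "f 0 = \<pi> $ 1
    \<and> f 1 = \<pi> $ 2 * p 1 2 + \<pi> $ 3 * p 1 3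
    \<and> f 2 = \<pi> $ 2 * (p 1 1 * p 1 2 + p 1 3 * p 3 2)
          + \<pi> $ 3 * (p 1 1 * p 1 3 + p 1 2 * p 2 3)
    \<and> f 3 = \<pi> $ 2 * (p 1 1 * p 1 1 * p 1 2 + p 1 1 * p 1 3 * p 3 2
                    + p 1 3 * p 3 3 * p 3 2 + p 1 3 * p 3 1 * p 1 2)
          + \<pi> $ 3 * (p 1 1 * p 1 1 * p 1 3 + p 1 1 * p 1 2 * p 2 3
                    + p 1 2 * p 2 2 * p 2 3 + p 1 2 * p 2 1 * p 1 3)
    \<and> (\<forall>n\<ge>3. \<delta>2 > 0 \<longrightarrow> \<delta>3 > 0 \<longrightarrow>
         f n = \<pi> $ 2 * (a lam21 / (lam21 - lam23) * lam21 ^ (n - 1)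
                      - a lam23 / (lam21 - lam23) * lam23 ^ (n - 1))
             + \<pi> $ 3 * (b lam31 / (lam31 - lam32) * lam31 ^ (n - 1)
                      - b lam32 / (lam31 - lam32) * lam32 ^ (n - 1)))"
proof -
  define q where "q = \<P>(\<omega> in \<Omega>. X 0 \<omega> = 1)"
  \<comment> \<open>These are joint probabilities with the start in 1; the factor \<open>q\<close>
    is divided out only when passing to \<open>f\<close>.\<close>
  define g where "g j n = \<P>(\<omega> in \<Omega>. X n \<omega> = j \<and> (\<forall>k<n. X k \<omega> \<noteq> j) \<and> X 0 \<omega> = 1)" for j n
  have q: "q > 0" using start by (simp add: q_def)
  have f_g: "f n = (\<pi> $ 1 * g 1 n + \<pi> $ 2 * g 2 n + \<pi> $ 3 * g 3 n) / q" for n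
    by (simp add: f cond_prob_def prob_mixing_time[OF chain mixing] sum_3 g_def q_def)
  \<comment> \<open>A chain started in 1 meets the target 1 at time 0, so this target contributes to
    \<open>f 0\<close> only.\<close>
  have g_1: "g 1 n = (if n = 0 then q else 0)" for n
  proof (cases "n = 0")
    case False
    then have "g 1 n = measure \<Omega> {}" unfolding g_def by (intro arg_cong[of _ _ "measure \<Omega>"]) auto
    then show ?thesis using False by simp
  qed (simp add: g_def q_def)
  have g_0: "g j 0 = 0" if "j \<noteq> 1" for j
  proof -
    have "g j 0 = measure \<Omega> {}"
      unfolding g_def using that by (intro arg_cong[of _ _ "measure \<Omega>"]) auto
    then show ?thesis by simp
  qed
  \<comment> \<open>The two enumerations fix the roles \<open>(i, j, l)\<close>: the target 2 leaves
    the block on 1 and 3, the target 3 the block on 1 and 2.\<close>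
  have UNIV: "(UNIV :: 3 set) = {1, 2, 3}" "(UNIV :: 3 set) = {1, 3, 2}"
    by (auto simp: UNIV_3)
  have neq: "(1::3) \<noteq> 2" "(1::3) \<noteq> 3" "(2::3) \<noteq> 3" "(3::3) \<noteq> 2" by simp_all
  note passage2 = first_passage_three_states[OF chain UNIV(1) neq(1,2,3) g_def, folded q_def p]
    and passage3 = first_passage_three_states[OF chain UNIV(2) neq(2,1,4) g_def, folded q_def p]
  have "f 0 = \<pi> $ 1" using q by (simp add: f_g g_1 g_0)
  moreover have "f 1 = \<pi> $ 2 * p 1 2 + \<pi> $ 3 * p 1 3"
    using q by (simp add: f_g g_1 passage2(1)[simplified] passage3(1)[simplified] field_simps)
  moreover have "f 2 = \<pi> $ 2 * (p 1 1 * p 1 2 + p 1 3 * p 3 2)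
      + \<pi> $ 3 * (p 1 1 * p 1 3 + p 1 2 * p 2 3)"
    using q by (simp add: f_g g_1 passage2(2) passage3(2) field_simps)
  moreover have "f 3 = \<pi> $ 2 * (p 1 1 * p 1 1 * p 1 2 + p 1 1 * p 1 3 * p 3 2
        + p 1 3 * p 3 3 * p 3 2 + p 1 3 * p 3 1 * p 1 2)
      + \<pi> $ 3 * (p 1 1 * p 1 1 * p 1 3 + p 1 1 * p 1 2 * p 2 3
        + p 1 2 * p 2 2 * p 2 3 + p 1 2 * p 2 1 * p 1 3)"
  proof -
    \<comment> \<open>One step of the recurrence suffices: the product of the two diagonal entries
      coming from the trace cancels against the one in the determinant, leaving the four listed
      paths for each target.\<close>
    have "g 2 3 = (p 1 1 + p 3 3) * g 2 2 - (p 1 1 * p 3 3 - p 1 3 * p 3 1) * g 2 1"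
      "g 3 3 = (p 1 1 + p 2 2) * g 3 2 - (p 1 1 * p 2 2 - p 1 2 * p 2 1) * g 3 1"
      using passage2(3)[of 0] passage3(3)[of 0] by (simp_all only: add_0)
    then show ?thesis
      using q unfolding f_g g_1 passage2(1,2) passage3(1,2) by (simp add: field_simps)
  qed
  moreover have "f n = \<pi> $ 2 * (a lam21 / (lam21 - lam23) * lam21 ^ (n - 1)
        - a lam23 / (lam21 - lam23) * lam23 ^ (n - 1))
      + \<pi> $ 3 * (b lam31 / (lam31 - lam32) * lam31 ^ (n - 1)
        - b lam32 / (lam31 - lam32) * lam32 ^ (n - 1))"
    if "n \<ge> 3" "\<delta>2 > 0" "\<delta>3 > 0" for n
  proof -
    have "g 2 n = q * (a lam21 / (lam21 - lam23) * lam21 ^ (n - 1)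
        - a lam23 / (lam21 - lam23) * lam23 ^ (n - 1))"
      unfolding q_def
      by (rule first_passage_closed_form[OF chain UNIV(1) neq(1,2,3) g_def, folded p, OF \<delta>2 \<open>\<delta>2 > 0\<close> lam21 lam23 a])
        (use that in auto)
    moreover have "g 3 n = q * (b lam31 / (lam31 - lam32) * lam31 ^ (n - 1)
        - b lam32 / (lam31 - lam32) * lam32 ^ (n - 1))"
      unfolding q_def
      by (rule first_passage_closed_form[OF chain UNIV(2) neq(2,1,4) g_def, folded p, OF \<delta>3 \<open>\<delta>3 > 0\<close> lam31 lam32 b])
        (use that in auto)
    ultimately show ?thesis
      using that q by (simp add: f_g g_1 add_divide_distrib)
  qed
  ultimately show ?thesis by blast
qed

end
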